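(* Let $\mathcal{H}$ be a pseudohalfplane hypergraph on a finite totally ordered vertex set $V$ such that every pair of hyperedges of $\mathcal{H}$ has a common vertex. Then there exists a set of at most $3$ vertices of $V$ that intersects every hyperedge of $\mathcal{H}$.
   Context: A hypergraph $\mathcal{F}$ on a totally ordered finite vertex set $V$ (a family of subsets of $V$) is ABA-free if there are no two hyperedges $A,B\in\mathcal{F}$ and vertices $x<y<z$ with $x,z\in A\setminus B$ and $y\in B\setminus A$. For a family $\mathcal{F}$ of subsets of $V$ let $\bar{\mathcal{F}}=\{V\setminus F: F\in\mathcal{F}\}$. A hypergraph $\mathcal{H}$ on $V$ is a pseudohalfplane hypergraph if there exists an ABA-free hypergraph $\mathcal{F}$ on $V$ such that $\mathcal{H}\subseteq\mathcal{F}\cup\bar{\mathcal{F}}$. *)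

theory Defs
  imports Main
begin

definition hypergraph :: "'a set \<Rightarrow> 'a set set \<Rightarrow> bool" where
  "hypergraph V H \<longleftrightarrow> H \<subseteq> Pow V"

definition ABA_free :: "'a::linorder set \<Rightarrow> 'a set set \<Rightarrow> bool" where
  "ABA_free V F \<longleftrightarrow> hypergraph V F \<and>
     \<not> (\<exists>A\<in>F. \<exists>B\<in>F. \<exists>x\<in>V. \<exists>y\<in>V. \<exists>z\<in>V.
          x < y \<and> y < z \<and> x \<in> A - B \<and> z \<in> A - B \<and> y \<in> B - A)"

definition complement_family :: "'a set \<Rightarrow> 'a set set \<Rightarrow> 'a set set" where
  "complement_family V F = {V - A | A. A \<in> F}"

definition pseudohalfplane_hypergraph :: "'a::linorder set \<Rightarrow> 'a set set \<Rightarrow> bool" where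
  "pseudohalfplane_hypergraph V H \<longleftrightarrow> hypergraph V H \<and>
     (\<exists>F. ABA_free V F \<and> H \<subseteq> F \<union> complement_family V F)"

(* The two hyperedges may coincide, so every hyperedge is nonempty. With distinct pairs
   only, the family consisting of just the empty set would qualify and have no hitting set. *)
definition pairwise_intersecting :: "'a set set \<Rightarrow> bool" where
  "pairwise_intersecting H \<longleftrightarrow> (\<forall>A\<in>H. \<forall>B\<in>H. A \<inter> B \<noteq> {})"

definition hitting_set :: "'a set \<Rightarrow> 'a set set \<Rightarrow> bool" where
  "hitting_set S H \<longleftrightarrow> (\<forall>A\<in>H. S \<inter> A \<noteq> {})"

end

theory Submission
  imports Defs
begin

text \<open>Call the vertices not skipped by any set of \<open>F\<close> the upper hull and those not skipped by any
  complement the lower hull, and walk around both hulls cyclically. Every hyperedge then occupies an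
  arc of the cycle, and two hyperedges with a common vertex, on the hull or not, have arcs that
  overlap or are adjacent. For such arcs let \<open>[a, b]\<close> be a shortest one. An arc avoiding \<open>a\<close> and
  \<open>b\<close> contains one of the neighbours \<open>c = b + 1\<close> and \<open>d = a - 1\<close>. If the shortest arc
  \<open>[c, e]\<close> and the shortest arc \<open>[f, d]\<close> overlap, then \<open>a\<close>, \<open>b\<close>, \<open>f\<close> hit everything; otherwise
  \<open>f = e + 1\<close>, the three arcs partition the cycle, and their first points \<open>a\<close>, \<open>c\<close>, \<open>f\<close> do.\<close>

section \<open>Pairwise touching arcs of a cycle\<close>

lemma first_exit:
  fixes i j :: int
  assumes "i < j" "P i" "\<not> P j"
  shows "\<exists>b. i \<le> b \<and> b < j \<and> (\<forall>m\<in>{i..b}. P m) \<and> \<not> P (b + 1)"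
proof -
  define k where "k = (LEAST k::nat. \<not> P (i + int k))"
  have *: "\<not> P (i + int (nat (j - i)))" using assms by simp
  have k: "\<not> P (i + int k)" "k \<le> nat (j - i)"
    unfolding k_def
    using LeastI[of "\<lambda>k. \<not> P (i + int k)", OF *] Least_le[of "\<lambda>k. \<not> P (i + int k)", OF *] by auto
  have less: "P (i + int m)" if "m < k" for m
    using that not_less_Least unfolding k_def by blast
  have "k \<noteq> 0" using k(1) assms(2) by (intro notI) simp
  have "P m" if "m \<in> {i..i + int k - 1}" for m
    using less[of "nat (m - i)"] that k(2) by (simp add: nat_less_iff)
  then show ?thesis
    using k \<open>k \<noteq> 0\<close> assms(1) by (intro exI[of _ "i + int k - 1"]) auto
qed

text \<open>The cycle is unrolled to a periodic word on the integers, so an arc is a plain interval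
  even where it wraps around. A set containing every letter has no arc in this sense.\<close>

definition arc_of :: "(int \<Rightarrow> 'a) \<Rightarrow> 'a set \<Rightarrow> int \<Rightarrow> int \<Rightarrow> bool" where
  "arc_of w E a b \<longleftrightarrow>
     a \<le> b \<and> (\<forall>i\<in>{a..b}. w i \<in> E) \<and> w (a - 1) \<notin> E \<and> w (b + 1) \<notin> E"

definition touching :: "(int \<Rightarrow> 'a) \<Rightarrow> 'a set \<Rightarrow> 'a set \<Rightarrow> bool" where
  "touching w E E' \<longleftrightarrow> (\<exists>i j. \<bar>i - j\<bar> \<le> 1 \<and> w i \<in> E \<and> w j \<in> E')"

text \<open>The positions of \<open>E\<close> form at most one arc of the cycle: no in-out-in-out
  pattern fits into a period.\<close>

definition cyclic_convex :: "(int \<Rightarrow> 'a) \<Rightarrow> int \<Rightarrow> 'a set \<Rightarrow> bool" where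
  "cyclic_convex w n E \<longleftrightarrow> (\<forall>i j k l. i < j \<longrightarrow> j < k \<longrightarrow> k < l \<longrightarrow> l < i + n \<longrightarrow>
     w i \<in> E \<longrightarrow> w j \<notin> E \<longrightarrow> w k \<in> E \<longrightarrow> w l \<in> E)"

lemma arc_between:
  assumes "l < i" "i < r" "w l \<notin> E" "w i \<in> E" "w r \<notin> E"
  shows "\<exists>a b. l < a \<and> a \<le> i \<and> i \<le> b \<and> b < r \<and> arc_of w E a b"
proof -
  obtain b where b: "i \<le> b" "b < r" "\<forall>m\<in>{i..b}. w m \<in> E" "w (b + 1) \<notin> E"
    using first_exit[of i r "\<lambda>m. w m \<in> E"] assms by auto
  \<comment> \<open>The left end comes from a reflection, so this \<open>a\<close> is its
    negative.\<close>
  obtain a where a: "- i \<le> a" "a < - l" "\<forall>m\<in>{- i..a}. w (- m) \<in> E" "w (- (a + 1)) \<notin> E"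
    using first_exit[of "- i" "- l" "\<lambda>m. w (- m) \<in> E"] assms by auto
  have "w m \<in> E" if "m \<in> {- a..b}" for m
  proof (cases "m \<le> i")
    case True
    then show ?thesis using a(3)[rule_format, of "- m"] that by simp
  next
    case False
    then show ?thesis using b(3) that by simp
  qed
  moreover have "w (- a - 1) \<notin> E"
  proof -
    have "- (a + 1) = - a - 1" by simp
    then show ?thesis using a(4) by metis
  qed
  ultimately show ?thesis
    using a(1,2) b(1,2,4) unfolding arc_of_def by (intro exI[of _ "- a"] exI[of _ b]) auto
qed

text \<open>The first position after leaving \<open>E\<close> is adjacent to a letter of
  \<open>E\<close>, so without touching it avoids \<open>E'\<close> as well.\<close>

lemma gap_between:
  assumes "i < j" "w i \<in> E" "w j \<in> E'" "\<not> touching w E E'"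
  shows "\<exists>g. i < g \<and> g < j \<and> w g \<notin> E \<and> w g \<notin> E'"
proof -
  have no: "\<not> (w x \<in> E \<and> w y \<in> E')" if "\<bar>x - y\<bar> \<le> 1" for x y
    using assms(4) that unfolding touching_def by blast
  then have "w j \<notin> E" using assms(3) by (metis abs_0 diff_self zero_le_one)
  then obtain b where b: "i \<le> b" "b < j" "\<forall>m\<in>{i..b}. w m \<in> E" "w (b + 1) \<notin> E"
    using first_exit[of i j "\<lambda>m. w m \<in> E"] assms by auto
  then have "w (b + 1) \<notin> E'" using no[of b "b + 1"] by auto
  moreover from this have "b + 1 \<noteq> j" using assms(3) by blast
  ultimately show ?thesis using b by (intro exI[of _ "b + 1"]) auto
qed

lemma touching_sym: "touching w E E' \<Longrightarrow> touching w E' E"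
  unfolding touching_def by (metis abs_minus_commute)

locale cyclic_word =
  fixes w :: "int \<Rightarrow> 'a" and n :: int
  assumes pos: "0 < n" and period: "w (i + n) = w i"
begin

lemma period_mult: "w (i + k * n) = w i"
proof (induction k rule: int_induct[of _ 0])
  case (step1 k)
  then show ?case using period[of "i + k * n"] by (simp add: algebra_simps)
next
  case (step2 k)
  then show ?case using period[of "i + (k - 1) * n"] by (simp add: algebra_simps)
qed simp

lemma shift_into: "\<exists>k. a \<le> i + k * n \<and> i + k * n < a + n"
proof -
  have "(i - a) div n * n + (i - a) mod n = i - a" by (rule div_mult_mod_eq)
  moreover have "i + (- ((i - a) div n)) * n = i - (i - a) div n * n" by simp
  ultimately have "i + (- ((i - a) div n)) * n = a + (i - a) mod n" by linarith
  then show ?thesis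
    using pos_mod_bound[OF pos, of "i - a"] pos_mod_sign[OF pos, of "i - a"]
    by (intro exI[of _ "- ((i - a) div n)"]) linarith
qed

lemma touching_shifted:
  assumes "touching w E E'"
  obtains i j where "a \<le> i" "i < a + n" "\<bar>i - j\<bar> \<le> 1" "w i \<in> E" "w j \<in> E'"
proof -
  obtain i j where ij: "\<bar>i - j\<bar> \<le> 1" "w i \<in> E" "w j \<in> E'"
    using assms unfolding touching_def by blast
  obtain k where k: "a \<le> i + k * n" "i + k * n < a + n" using shift_into by blast
  show ?thesis
    using that[of "i + k * n" "j + k * n"] ij k by (simp add: period_mult)
qed

text \<open>A letter of \<open>E\<close> at \<open>i\<close> would complete an in-out-in-out pattern
  with \<open>a\<close>, \<open>b + 1\<close> and \<open>a - 1 + n\<close>, the position just before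
  the next copy of the arc.\<close>

lemma arc_complement:
  assumes "cyclic_convex w n E" "arc_of w E a b" "b < i" "i < a + n"
  shows "w i \<notin> E"
proof
  assume i: "w i \<in> E"
  have E: "w a \<in> E" "w (b + 1) \<notin> E" "w (a - 1 + n) \<notin> E" "a \<le> b"
    using assms(2) period[of "a - 1"] unfolding arc_of_def by auto
  then have "i \<noteq> b + 1" "i \<noteq> a - 1 + n" using i by auto
  then have "a < b + 1" "b + 1 < i" "i < a - 1 + n" "a - 1 + n < a + n"
    using assms(3,4) E(4) by linarith+
  then show False using assms(1) E i unfolding cyclic_convex_def by blast
qed

lemma three_points_hit_touching_arcs:
  assumes convex: "\<And>E. E \<in> H \<Longrightarrow> cyclic_convex w n E"
    and ne: "\<And>E. E \<in> H \<Longrightarrow> \<exists>i. w i \<in> E"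
    and touch: "\<And>E E'. E \<in> H \<Longrightarrow> E' \<in> H \<Longrightarrow> touching w E E'"
  shows "\<exists>i j k. \<forall>E\<in>H. w i \<in> E \<or> w j \<in> E \<or> w k \<in> E"
proof (cases "\<forall>E\<in>H. \<forall>i. w i \<in> E")
  case True
  then show ?thesis by blast
next
  case False
  then obtain E0 l where E0: "E0 \<in> H" "w l \<notin> E0" by blast
  obtain i0 where "w i0 \<in> E0" using ne E0 by blast
  moreover obtain k where k: "l \<le> i0 + k * n" "i0 + k * n < l + n" using shift_into by blast
  ultimately have "w (i0 + k * n) \<in> E0" by (simp add: period_mult)
  \<comment> \<open>\<open>E0\<close> misses \<open>l\<close> and its copy \<open>l + n\<close>, so
    a maximal run of \<open>E0\<close> lies between them.\<close>
  with E0(2) k have "\<exists>a b. arc_of w E0 a b"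
    using arc_between[of l "i0 + k * n" "l + n" w E0] period by (metis order_le_less)
  with E0(1) have ex: "\<exists>x. case x of (E, a, b) \<Rightarrow> E \<in> H \<and> arc_of w E a b" by auto
  obtain h a b where h: "h \<in> H" "arc_of w h a b"
    and least: "\<And>E a' b'. E \<in> H \<Longrightarrow> arc_of w E a' b' \<Longrightarrow> nat (b - a) \<le> nat (b' - a')"
    using ex_has_least_nat[of "\<lambda>(E, a, b). E \<in> H \<and> arc_of w E a b" _ "\<lambda>(E, a, b). nat (b - a)"] ex
    by (fastforce simp: split_paired_all)
  have least: "b - a \<le> b' - a'" if "E \<in> H" "arc_of w E a' b'" for E a' b'
    using least[OF that] that(2) unfolding arc_of_def by auto
  have ab: "a \<le> b" "\<And>i. a \<le> i \<Longrightarrow> i \<le> b \<Longrightarrow> w i \<in> h" "w (a - 1) \<notin> h" "w (b + 1) \<notin> h"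
    using h(2) unfolding arc_of_def by auto
  \<comment> \<open>\<open>d\<close> is the left neighbour of \<open>[a, b]\<close> moved on by one
    period, so that \<open>c\<close> to \<open>d\<close> runs through the positions outside
    \<open>[a, b]\<close>.\<close>
  define c d where "c = b + 1" and "d = a - 1 + n"
  have wd: "w d = w (a - 1)" "w (d + 1) = w a"
    using period[of "a - 1"] period[of a] unfolding d_def by simp_all
  have "w d \<notin> h" using ab(3) wd by simp
  have "c \<le> d"
  proof (rule ccontr)
    assume "\<not> c \<le> d"
    then have "w d \<in> h" using ab(2)[of d] pos unfolding c_def d_def by simp
    then show False using \<open>w d \<notin> h\<close> by blast
  qed
  have covered: "w c \<in> E \<or> w d \<in> E" if E: "E \<in> H" "w a \<notin> E" "w b \<notin> E" for E
  proof -
    \<comment> \<open>A position of \<open>[a, b]\<close> in \<open>E\<close> would lie on an arc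
      strictly inside \<open>[a, b]\<close>, against the choice of a shortest arc. Hence
      \<open>E\<close> touches \<open>h\<close> only through a neighbour of
      \<open>[a, b]\<close>.\<close>
    have out: "w i \<notin> E" if i: "a \<le> i" "i \<le> b" for i
    proof
      assume "w i \<in> E"
      moreover from this have "a < i" "i < b" using E i by (auto simp: order_le_less)
      ultimately obtain a' b' where "a < a'" "b' < b" "arc_of w E a' b'"
        using arc_between[of a i b w E] E by blast
      then show False using least[OF E(1), of a' b'] by simp
    qed
    obtain i j where ij: "a \<le> i" "i < a + n" "\<bar>i - j\<bar> \<le> 1" "w i \<in> h" "w j \<in> E"
      using touching_shifted[OF touch[OF h(1) E(1)]] by metis
    have "i \<le> b" using arc_complement[OF convex[OF h(1)] h(2), of i] ij by force
    moreover have "\<not> (a \<le> j \<and> j \<le> b)" using out ij(5) by blast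
    ultimately have "j = a - 1 \<or> j = b + 1" using ij by linarith
    then show ?thesis using ij(5) wd unfolding c_def by auto
  qed
  \<comment> \<open>Members of \<open>G1\<close> and \<open>G2\<close> contain just one of the two
    neighbours. If either family is empty, a single neighbour hits all that \<open>a\<close> and
    \<open>b\<close> miss.\<close>
  define G1 where "G1 = {E \<in> H. w a \<notin> E \<and> w b \<notin> E \<and> w c \<in> E \<and> w d \<notin> E}"
  define G2 where "G2 = {E \<in> H. w a \<notin> E \<and> w b \<notin> E \<and> w c \<notin> E \<and> w d \<in> E}"
  show ?thesis
  proof (cases "G1 = {} \<or> G2 = {}")
    case True
    then have "(\<forall>E\<in>H. w a \<in> E \<or> w b \<in> E \<or> w d \<in> E) \<or> (\<forall>E\<in>H. w a \<in> E \<or> w b \<in> E \<or> w c \<in> E)"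
      using covered unfolding G1_def G2_def by blast
    then show ?thesis by blast
  next
    case False
    \<comment> \<open>Position \<open>c - 1\<close> is \<open>b\<close> and \<open>d + 1\<close>
      carries the letter of \<open>a\<close>. Both are avoided, so arcs in \<open>G1\<close> start
      exactly at \<open>c\<close> and arcs in \<open>G2\<close> end exactly at
      \<open>d\<close>.\<close>
    have arc1: "\<exists>e. c \<le> e \<and> e < d \<and> arc_of w E c e" if "E \<in> G1" for E
    proof -
      have cd: "c < d" "w (c - 1) \<notin> E" "w c \<in> E" "w d \<notin> E"
        using that \<open>c \<le> d\<close> unfolding G1_def c_def by (auto simp: order_le_less)
      then obtain c' e where "c - 1 < c'" "c' \<le> c" "c \<le> e" "e < d" "arc_of w E c' e"
        using arc_between[of "c - 1" c d w E, OF _ _ cd(2-4)] by auto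
      moreover from this have "c' = c" by simp
      ultimately show ?thesis by blast
    qed
    have arc2: "\<exists>f. c < f \<and> f \<le> d \<and> arc_of w E f d" if "E \<in> G2" for E
    proof -
      have cd: "c < d" "w (d + 1) \<notin> E" "w c \<notin> E" "w d \<in> E"
        using that \<open>c \<le> d\<close> wd unfolding G2_def by (auto simp: order_le_less)
      then obtain f g where "c < f" "f \<le> d" "d \<le> g" "g < d + 1" "arc_of w E f g"
        using arc_between[of c d "d + 1" w E, OF _ _ cd(3,4,2)] by auto
      moreover from this have "g = d" by simp
      ultimately show ?thesis by blast
    qed
    \<comment> \<open>By the extremal choice of \<open>e\<close> and \<open>f\<close>, all letters
      of \<open>[c, e]\<close> lie in every member of \<open>G1\<close>, and the letter at
      \<open>f\<close> lies in every member of \<open>G2\<close>.\<close>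
    obtain E1 e where E1: "E1 \<in> G1" "arc_of w E1 c e" "e < d"
      and e_least: "\<And>E e'. E \<in> G1 \<Longrightarrow> arc_of w E c e' \<Longrightarrow> e \<le> e'"
    proof -
      have "\<exists>x. case x of (E, e) \<Rightarrow> E \<in> G1 \<and> arc_of w E c e \<and> e < d"
        using arc1 False by auto
      then obtain E1 e where *: "E1 \<in> G1" "arc_of w E1 c e" "e < d"
        "\<And>E e'. E \<in> G1 \<Longrightarrow> arc_of w E c e' \<Longrightarrow> e' < d \<Longrightarrow> nat (e - c) \<le> nat (e' - c)"
        using ex_has_least_nat[of "\<lambda>(E, e). E \<in> G1 \<and> arc_of w E c e \<and> e < d" _ "\<lambda>(E, e). nat (e - c)"]
        by (fastforce simp: split_paired_all)
      have "e \<le> e'" if "E \<in> G1" "arc_of w E c e'" for E e'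
        using *(4)[OF that] *(2,3) that(2) unfolding arc_of_def by fastforce
      then show ?thesis using that * by blast
    qed
    obtain E2 f where E2: "E2 \<in> G2" "arc_of w E2 f d" "c < f"
      and f_greatest: "\<And>E f'. E \<in> G2 \<Longrightarrow> arc_of w E f' d \<Longrightarrow> f' \<le> f"
    proof -
      have "\<exists>x. case x of (E, f) \<Rightarrow> E \<in> G2 \<and> arc_of w E f d \<and> c < f"
        using arc2 False by auto
      then obtain E2 f where *: "E2 \<in> G2" "arc_of w E2 f d" "c < f"
        "\<And>E f'. E \<in> G2 \<Longrightarrow> arc_of w E f' d \<Longrightarrow> c < f' \<Longrightarrow> nat (d - f) \<le> nat (d - f')"
        using ex_has_least_nat[of "\<lambda>(E, f). E \<in> G2 \<and> arc_of w E f d \<and> c < f" _ "\<lambda>(E, f). nat (d - f)"]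
        by (fastforce simp: split_paired_all)
      have "f' \<le> f" if "E \<in> G2" "arc_of w E f' d" for E f'
        using *(4)[OF that] *(2,3) that(2) unfolding arc_of_def by fastforce
      then show ?thesis using that * by blast
    qed
    have f_le: "f \<le> d" and c_le: "c \<le> e" using E1(2) E2(2) unfolding arc_of_def by auto
    have in1: "w i \<in> E" if "E \<in> G1" "c \<le> i" "i \<le> e" for E i
    proof -
      obtain e' where "arc_of w E c e'" using arc1 \<open>E \<in> G1\<close> by blast
      then show ?thesis using e_least[OF \<open>E \<in> G1\<close>] that unfolding arc_of_def by fastforce
    qed
    have in2: "w f \<in> E" if "E \<in> G2" for E
    proof -
      obtain f' where "arc_of w E f' d" using arc2 \<open>E \<in> G2\<close> by blast
      then show ?thesis using f_greatest[OF \<open>E \<in> G2\<close>] f_le unfolding arc_of_def by fastforce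
    qed
    show ?thesis
    proof (cases "f \<le> e")
      case True
      have "w f \<in> E" if E: "E \<in> H" "w a \<notin> E" "w b \<notin> E" for E
      proof (cases "E \<in> G1 \<or> E \<in> G2")
        case True
        then show ?thesis using in1 in2 \<open>f \<le> e\<close> E2(3) by auto
      next
        case False
        then have cd: "w c \<in> E" "w d \<in> E" using covered[OF E] E unfolding G1_def G2_def by auto
        \<comment> \<open>A hyperedge with \<open>c\<close> and \<open>d\<close> but without
          \<open>f\<close> between them contains \<open>d + 1\<close> by convexity, and that is the
          letter of \<open>a\<close>.\<close>
        show ?thesis
        proof (rule ccontr)
          assume nf: "w f \<notin> E"
          have "f < d" using \<open>f \<le> e\<close> E1(3) by simp
          moreover have "d + 1 < c + n" using ab(1) unfolding c_def d_def by simp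
          ultimately have "w (d + 1) \<in> E"
            using convex[OF E(1)] cd nf E2(3) unfolding cyclic_convex_def
            by (metis less_add_one)
          then show False using wd E by simp
        qed
      qed
      then show ?thesis by blast
    next
      case False
      have H12: "E1 \<in> H" "E2 \<in> H" using E1 E2 unfolding G1_def G2_def by auto
      obtain i j where ij: "c \<le> i" "i < c + n" "\<bar>i - j\<bar> \<le> 1" "w i \<in> E1" "w j \<in> E2"
        using touching_shifted[OF touch[OF H12]] by metis
      have "i \<le> e" using arc_complement[OF convex[OF H12(1)] E1(2), of i] ij by force
      have "f \<le> j"
      proof (rule ccontr)
        \<comment> \<open>\<open>E2\<close> avoids \<open>b = c - 1\<close>, so \<open>j\<close>
          would be one of \<open>c\<close> to \<open>f - 1\<close>; one period later it falls
          between \<open>[f, d]\<close> and the next copy of that arc.\<close>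
        assume "\<not> f \<le> j"
        moreover have "j \<noteq> b" using ij(5) E2(1) unfolding G2_def by blast
        ultimately have "d < j + n" "j + n < f + n" using ij ab(1) unfolding c_def d_def by auto
        then show False
          using arc_complement[OF convex[OF H12(2)] E2(2), of "j + n"] ij(5) period by simp
      qed
      then have f: "f = e + 1" using \<open>i \<le> e\<close> ij(3) False by linarith
      \<comment> \<open>If \<open>E\<close> misses \<open>a\<close> and \<open>c\<close> but
        contains \<open>b\<close>, its arc through \<open>b\<close> is shorter than
        \<open>[a, b]\<close>. If it misses \<open>b\<close> too, it must contain \<open>d\<close>,
        so it is in \<open>G2\<close> and contains \<open>f\<close>.\<close>
      have "w a \<in> E \<or> w c \<in> E \<or> w f \<in> E" if E: "E \<in> H" for E
      proof (rule ccontr)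
        assume no: "\<not> (w a \<in> E \<or> w c \<in> E \<or> w f \<in> E)"
        show False
        proof (cases "w b \<in> E")
          case True
          then have "a < b" using no ab(1) by (auto simp: order_le_less)
          then obtain a' b' where "a < a'" "b' < c" "arc_of w E a' b'"
            using arc_between[of a b c w E] True no unfolding c_def by auto
          then show False using least[OF E, of a' b'] unfolding c_def by simp
        next
          case False
          then have "E \<in> G2" using covered[OF E] no E unfolding G2_def by auto
          then show False using in2 no by blast
        qed
      qed
      then show ?thesis by blast
    qed
  qed
qed

end


section \<open>Unskippable vertices\<close>

definition unskippable :: "'a::linorder set \<Rightarrow> 'a set set \<Rightarrow> 'a set" where
  "unskippable V F = {v \<in> V. \<forall>A\<in>F. \<forall>x\<in>A. \<forall>z\<in>A. x < v \<longrightarrow> v < z \<longrightarrow> v \<in> A}"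

lemma ABA_freeD:
  assumes "ABA_free V F" "A \<in> F" "B \<in> F" "x \<in> A - B" "y \<in> B - A" "z \<in> A - B" "x < y" "y < z"
  shows False
proof -
  have "A \<subseteq> V" "B \<subseteq> V" using assms(1-3) unfolding ABA_free_def hypergraph_def by auto
  then have "x \<in> V" "y \<in> V" "z \<in> V" using assms(4-6) by auto
  then show False using assms unfolding ABA_free_def by blast
qed

text \<open>Complementing swaps the two differences, so a forbidden pattern reappears with
  \<open>A\<close> and \<open>B\<close> exchanged. This carries results from the upper hull to the
  lower one.\<close>

lemma ABA_free_complement:
  assumes "ABA_free V F"
  shows "ABA_free V (complement_family V F)"
proof -
  have False
    if "A \<in> F" "B \<in> F" "x \<in> V" "x \<notin> A" "x \<in> B" "z \<in> V" "z \<notin> A" "z \<in> B" "y \<notin> B" "y \<in> A"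
      "x < y" "y < z" for A B x y z
    using ABA_freeD[OF assms that(2,1), of x y z] that by blast
  note aux = this
  show ?thesis
    unfolding ABA_free_def hypergraph_def complement_family_def by (auto dest: aux)
qed

text \<open>Serves the induction that deletes the largest vertex: a pattern lies within
  \<open>W\<close>, where traces and original sets agree.\<close>

lemma ABA_free_trace:
  assumes "ABA_free V F"
  shows "ABA_free W ((\<lambda>A. A \<inter> W) ` F)"
proof -
  have False
    if "A \<in> F" "B \<in> F" "x \<in> A" "x \<notin> B" "z \<in> A" "z \<notin> B" "y \<in> B" "y \<notin> A"
      "x < y" "y < z" for A B x y z
    using ABA_freeD[OF assms that(1,2), of x y z] that by blast
  note aux = this
  show ?thesis
    unfolding ABA_free_def hypergraph_def by (auto dest: aux)
qed

text \<open>Induction adding the largest vertex \<open>b\<close>. If \<open>b\<close> is not in \<open>A\<close> but every vertex of \<open>A\<close> that was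
  unskippable before is skipped by a set through \<open>b\<close>, let \<open>B\<close> skip the leftmost such vertex \<open>v\<close>.
  ABA-freeness puts \<open>B\<close> left of \<open>v\<close> inside \<open>A\<close>, so all unskippable vertices of the trace of \<open>B\<close>
  lie right of \<open>v\<close> and already that trace skips \<open>v\<close>.\<close>

lemma meets_unskippable:
  assumes "finite V" "ABA_free V F" "A \<in> F" "A \<noteq> {}"
  shows "A \<inter> unskippable V F \<noteq> {}"
  using assms
proof (induction V arbitrary: F A rule: finite_linorder_max_induct)
  case empty
  then show ?case unfolding ABA_free_def hypergraph_def by auto
next
  case (insert b W)
  have sub: "B \<subseteq> insert b W" if "B \<in> F" for B
    using insert.prems(1) that unfolding ABA_free_def hypergraph_def by auto
  show ?case
  proof (cases "b \<in> A")
    case True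
    \<comment> \<open>Nothing lies right of the largest vertex, so no set skips it.\<close>
    have "b \<in> unskippable (insert b W) F"
      unfolding unskippable_def using sub insert.hyps(2) by fastforce
    then show ?thesis using True by blast
  next
    case False
    define F' where "F' = (\<lambda>A. A \<inter> W) ` F"
    have F': "ABA_free W F'" unfolding F'_def by (rule ABA_free_trace[OF insert.prems(1)])
    have AW: "A \<subseteq> W" using sub[OF insert.prems(2)] False by blast
    have "A \<in> F'" using AW insert.prems(2) unfolding F'_def by (metis image_eqI inf.absorb1)
    then have ne: "A \<inter> unskippable W F' \<noteq> {}"
      using insert.IH[OF F'] insert.prems(3) by blast
    have fin: "finite (A \<inter> unskippable W F')"
      using AW insert.hyps(1) finite_subset by blast
    define v where "v = Min (A \<inter> unskippable W F')"
    have v: "v \<in> A" "v \<in> unskippable W F'" using Min_in[OF fin ne] unfolding v_def by auto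
    have v_min: "v \<le> u" if "u \<in> A" "u \<in> unskippable W F'" for u
      using Min_le[OF fin] that unfolding v_def by blast
    show ?thesis
    proof (rule ccontr)
      assume "\<not> ?thesis"
      then have "v \<notin> unskippable (insert b W) F" using v(1) by blast
      then obtain B x z where B: "B \<in> F" "x \<in> B" "z \<in> B" "x < v" "v < z" "v \<notin> B"
        using v(1) AW unfolding unskippable_def by auto
      have B': "B \<inter> W \<in> F'" using B(1) unfolding F'_def by blast
      \<comment> \<open>The traces do not skip \<open>v\<close>, so \<open>B\<close> can do so only
        with the help of \<open>b\<close>.\<close>
      have no_skip: "\<not> (p \<in> B \<and> p \<in> W \<and> p < v \<and> q \<in> B \<and> q \<in> W \<and> v < q)" for p q
      proof -
        have "\<forall>x\<in>B \<inter> W. \<forall>z\<in>B \<inter> W. x < v \<longrightarrow> v < z \<longrightarrow> v \<in> B \<inter> W"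
          using bspec[OF _ B', of "\<lambda>A. \<forall>x\<in>A. \<forall>z\<in>A. x < v \<longrightarrow> v < z \<longrightarrow> v \<in> A"] v(2)
          unfolding unskippable_def by blast
        then show ?thesis using B(6) by blast
      qed
      have "v < b" using v(1) AW insert.hyps(2) by blast
      then have "x \<in> W" using B(2,4) sub[OF B(1)] by fastforce
      then have "z = b" using no_skip B(2-5) sub[OF B(1)] by blast
      have left: "p \<in> A" if "p \<in> B" "p < v" for p
        using ABA_freeD[OF insert.prems(1) B(1) insert.prems(2), of p v b]
          that v(1) B(3,6) \<open>z = b\<close> False \<open>v < b\<close> by blast
      have "B \<inter> W \<inter> unskippable W F' \<noteq> {}"
        using insert.IH[OF F' B'] \<open>x \<in> W\<close> B(2) by blast
      then obtain u where u: "u \<in> B" "u \<in> W" "u \<in> unskippable W F'" by blast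
      then have "v < u" using v_min left B(6) by (metis linorder_neqE not_le)
      then show False using no_skip u B(2,4) \<open>x \<in> W\<close> by blast
    qed
  qed
qed

section \<open>The cyclic order of the unskippable vertices\<close>

text \<open>Positions \<open>0, \<dots>, k - 1\<close> run left to right through the vertices unskippable for \<open>F\<close> (the upper
  hull), positions \<open>k, \<dots>, n - 1\<close> run right to left through those unskippable for the complements
  (the lower hull); a vertex on both hulls is visited twice.\<close>

locale hull_walk = cyclic_word w n
  for w :: "int \<Rightarrow> 'a::linorder" and n :: int +
  fixes V :: "'a set" and F :: "'a set set" and k :: int
  assumes ABA: "ABA_free V F"
    and k: "0 \<le> k" "k \<le> n"
    and upper: "i \<in> {0..<k} \<Longrightarrow> w i \<in> unskippable V F"
    and lower: "i \<in> {k..<n} \<Longrightarrow> w i \<in> unskippable V (complement_family V F)"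
    and upper_mono: "0 \<le> i \<Longrightarrow> i < j \<Longrightarrow> j < k \<Longrightarrow> w i < w j"
    and lower_mono: "k \<le> i \<Longrightarrow> i < j \<Longrightarrow> j < n \<Longrightarrow> w j < w i"
    and upper_ex: "v \<in> unskippable V F \<Longrightarrow> \<exists>i\<in>{0..<k}. w i = v"
    and lower_ex: "v \<in> unskippable V (complement_family V F) \<Longrightarrow> \<exists>i\<in>{k..<n}. w i = v"
begin

section \<open>Hyperedges as arcs of the walk\<close>

lemma upperD:
  assumes "A \<in> F" "x \<in> A" "z \<in> A" "i \<in> {0..<k}" "w i \<notin> A"
  shows "\<not> (x < w i \<and> w i < z)"
  using upper[OF assms(4)] assms unfolding unskippable_def by blast

lemma lowerD:
  assumes "A \<in> F" "x \<in> V - A" "z \<in> V - A" "i \<in> {k..<n}" "w i \<in> A"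
  shows "\<not> (x < w i \<and> w i < z)"
  using lower[OF assms(4)] assms unfolding unskippable_def complement_family_def by blast

lemma w_in_V: "i \<in> {0..<n} \<Longrightarrow> w i \<in> V"
  using upper[of i] lower[of i] unfolding unskippable_def by (cases "i < k") auto

lemma w_in_V_all: "w i \<in> V"
proof -
  obtain m where "0 \<le> i + m * n" "i + m * n < 0 + n" using shift_into by blast
  then show ?thesis using w_in_V[of "i + m * n"] period_mult by simp
qed

text \<open>The cases record where \<open>k\<close> separates the four positions. In each, any
  relative order of the vertices makes \<open>A\<close> skip an upper vertex or its complement skip
  a lower one.\<close>

lemma no_alternation:
  assumes A: "A \<in> F" and i: "0 \<le> i1" "i1 < i2" "i2 < i3" "i3 < i4" "i4 < n"
    and alt: "w i1 \<in> A \<longleftrightarrow> w i2 \<notin> A" "w i2 \<in> A \<longleftrightarrow> w i3 \<notin> A" "w i3 \<in> A \<longleftrightarrow> w i4 \<notin> A"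
  shows False
proof -
  note inV = w_in_V_all[of i1] w_in_V_all[of i2] w_in_V_all[of i3] w_in_V_all[of i4]
  consider "i4 < k" | "i3 < k" "k \<le> i4" | "i2 < k" "k \<le> i3" | "i1 < k" "k \<le> i2" | "k \<le> i1"
    by linarith
  then show False
  proof cases
    case 1
    then have "w i1 < w i2" "w i2 < w i3" "w i3 < w i4" using i upper_mono by auto
    moreover have "i2 \<in> {0..<k}" "i3 \<in> {0..<k}" using 1 i by auto
    ultimately show False using upperD[OF A] alt by blast
  next
    case 2
    then have ord: "w i1 < w i2" "w i2 < w i3" using i upper_mono by auto
    have dom: "i1 \<in> {0..<k}" "i2 \<in> {0..<k}" "i3 \<in> {0..<k}" "i4 \<in> {k..<n}" using 2 i by auto
    note pos = ord dom
    show False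
    proof (cases "w i1 \<in> A")
      case True
      then show False using upperD[OF A, of "w i1" "w i3" i2] pos alt by blast
    next
      case False
      \<comment> \<open>If \<open>w i4\<close> lies between \<open>w i1\<close> and
        \<open>w i3\<close>, the complement skips it; otherwise \<open>A\<close> skips
        \<open>w i1\<close> or \<open>w i3\<close>.\<close>
      then have "\<not> (w i1 < w i4 \<and> w i4 < w i3)" "\<not> w i4 < w i1" "\<not> w i3 < w i4"
        using lowerD[OF A, of "w i1" "w i3" i4] upperD[OF A, of "w i4" "w i2" i1]
          upperD[OF A, of "w i2" "w i4" i3] pos alt inV by blast+
      moreover have "w i4 \<noteq> w i1" "w i4 \<noteq> w i3" using False alt by metis+
      ultimately show False by (meson linorder_neqE)
    qed
  next
    case 3
    then have ord: "w i1 < w i2" "w i4 < w i3" using i upper_mono lower_mono by auto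
    have dom: "i1 \<in> {0..<k}" "i2 \<in> {0..<k}" "i3 \<in> {k..<n}" "i4 \<in> {k..<n}" using 3 i by auto
    note pos = ord dom
    show False
    proof (cases "w i1 \<in> A")
      case True
      \<comment> \<open>Here the right vertices of the two pairs are compared, in the other case the
        left ones; either order yields a skipped vertex.\<close>
      then have "\<not> w i2 < w i3" "\<not> w i3 < w i2"
        using upperD[OF A, of "w i1" "w i3" i2] lowerD[OF A, of "w i4" "w i2" i3] pos alt inV
        by blast+
      moreover have "w i2 \<noteq> w i3" using True alt by metis
      ultimately show False by (meson linorder_neqE)
    next
      case False
      then have "\<not> w i4 < w i1" "\<not> w i1 < w i4"
        using upperD[OF A, of "w i4" "w i2" i1] lowerD[OF A, of "w i1" "w i3" i4] pos alt inV
        by blast+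
      moreover have "w i4 \<noteq> w i1" using False alt by metis
      ultimately show False by (meson linorder_neqE)
    qed
  next
    case 4
    then have ord: "w i3 < w i2" "w i4 < w i3" using i lower_mono by auto
    have dom: "i1 \<in> {0..<k}" "i2 \<in> {k..<n}" "i3 \<in> {k..<n}" "i4 \<in> {k..<n}" using 4 i by auto
    note pos = ord dom
    show False
    proof (cases "w i1 \<in> A")
      case True
      then show False using lowerD[OF A, of "w i4" "w i2" i3] pos alt inV by blast
    next
      case False
      then have "\<not> (w i4 < w i1 \<and> w i1 < w i2)" "\<not> w i1 < w i4" "\<not> w i2 < w i1"
        using upperD[OF A, of "w i4" "w i2" i1] lowerD[OF A, of "w i1" "w i3" i4]
          lowerD[OF A, of "w i3" "w i1" i2] pos alt inV by blast+
      moreover have "w i1 \<noteq> w i4" "w i1 \<noteq> w i2" using False alt by metis+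
      ultimately show False by (meson linorder_neqE)
    qed
  next
    case 5
    then have "w i2 < w i1" "w i3 < w i2" "w i4 < w i3" using i lower_mono by auto
    moreover have "i2 \<in> {k..<n}" "i3 \<in> {k..<n}" using 5 i by auto
    ultimately show False using lowerD[OF A] alt inV by blast
  qed
qed

text \<open>An alternation of even length survives rotation, so positions past \<open>n\<close> can
  be moved back by a period to the front.\<close>

lemma no_cyclic_alternation:
  assumes A: "A \<in> F" and i: "i1 < i2" "i2 < i3" "i3 < i4" "i4 < i1 + n"
    and alt: "w i1 \<in> A \<longleftrightarrow> w i2 \<notin> A" "w i2 \<in> A \<longleftrightarrow> w i3 \<notin> A" "w i3 \<in> A \<longleftrightarrow> w i4 \<notin> A"
  shows False
proof -
  obtain m where m: "0 \<le> i1 + m * n" "i1 + m * n < 0 + n" using shift_into by blast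
  define j1 j2 j3 j4 where j: "j1 = i1 + m * n" "j2 = i2 + m * n" "j3 = i3 + m * n" "j4 = i4 + m * n"
  have ord: "0 \<le> j1" "j1 < n" "j1 < j2" "j2 < j3" "j3 < j4" "j4 < j1 + n" using m i unfolding j by auto
  have wj: "w j1 = w i1" "w j2 = w i2" "w j3 = w i3" "w j4 = w i4" unfolding j by (simp_all add: period_mult)
  have per: "w (j - n) = w j" for j using period[of "j - n"] by simp
  consider "j4 < n" | "j3 < n" "n \<le> j4" | "j2 < n" "n \<le> j3" | "n \<le> j2" by linarith
  then show False
  proof cases
    case 1
    then show False using no_alternation[OF A, of j1 j2 j3 j4] ord alt wj by simp
  next
    case 2
    then show False using no_alternation[OF A, of "j4 - n" j1 j2 j3] ord alt wj per by auto
  next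
    case 3
    then show False using no_alternation[OF A, of "j3 - n" "j4 - n" j1 j2] ord alt wj per by auto
  next
    case 4
    then show False using no_alternation[OF A, of "j2 - n" "j3 - n" "j4 - n" j1] ord alt wj per by auto
  qed
qed

text \<open>Alternation is symmetric between a set and its complement, so one lemma about
  \<open>A\<close> serves both kinds of hyperedge.\<close>

lemma cyclic_convex_hyperedge:
  assumes "E \<in> F \<union> complement_family V F"
  shows "cyclic_convex w n E"
proof -
  obtain A where A: "A \<in> F" "E = A \<or> E = V - A"
    using assms unfolding complement_family_def by blast
  have "(w i \<in> E \<longleftrightarrow> w i \<in> A) \<or> E = V - A" "E = A \<or> (w i \<in> E \<longleftrightarrow> w i \<notin> A)" for i
    using A(2) w_in_V_all by auto
  then have *: "(\<forall>i. w i \<in> E \<longleftrightarrow> w i \<in> A) \<or> (\<forall>i. w i \<in> E \<longleftrightarrow> w i \<notin> A)"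
    using A(2) by blast
  show ?thesis
    unfolding cyclic_convex_def
  proof (intro allI impI)
    fix i1 i2 i3 i4
    assume "i1 < i2" "i2 < i3" "i3 < i4" "i4 < i1 + n" "w i1 \<in> E" "w i2 \<notin> E" "w i3 \<in> E"
    then show "w i4 \<in> E"
      using no_cyclic_alternation[OF A(1), of i1 i2 i3 i4] * by blast
  qed
qed

section \<open>Intersecting hyperedges touch\<close>

lemma upper_meets:
  assumes "finite V" "A \<in> F" "A \<noteq> {}"
  shows "\<exists>i\<in>{0..<k}. w i \<in> A"
  using meets_unskippable[OF assms(1) ABA assms(2,3)] upper_ex by blast

lemma lower_meets:
  assumes "finite V" "A \<in> F" "V - A \<noteq> {}"
  shows "\<exists>i\<in>{k..<n}. w i \<in> V - A"
  using meets_unskippable[OF assms(1) ABA_free_complement[OF ABA], of "V - A"] assms lower_ex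
  unfolding complement_family_def by blast

text \<open>Otherwise an upper vertex \<open>w g\<close> outside both sets lies between a letter of
  \<open>A\<close> and one of \<open>B\<close>. The set whose letter is on the far side from
  \<open>p\<close> skips \<open>w g\<close>.\<close>

lemma touching_upper_upper:
  assumes "finite V" "A \<in> F" "B \<in> F" "p \<in> A" "p \<in> B"
  shows "touching w A B"
proof -
  have aux: "touching w A B"
    if AB: "A \<in> F" "B \<in> F" "p \<in> A" "p \<in> B" and ij: "0 \<le> i" "i < j" "j < k" "w i \<in> A" "w j \<in> B"
    for A B i j
  proof (rule ccontr)
    assume "\<not> touching w A B"
    then obtain g where g: "i < g" "g < j" "w g \<notin> A" "w g \<notin> B"
      using gap_between[OF ij(2,4,5)] by blast
    then have "w i < w g" "w g < w j" "g \<in> {0..<k}" using upper_mono ij by auto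
    then have "\<not> w g < p" "\<not> p < w g" using upperD AB ij g by blast+
    then show False using g AB by auto
  qed
  obtain i where i: "i \<in> {0..<k}" "w i \<in> A" using upper_meets assms by blast
  obtain j where j: "j \<in> {0..<k}" "w j \<in> B" using upper_meets assms by blast
  consider "i < j" | "j < i" | "i = j" by linarith
  then show ?thesis
  proof cases
    case 3
    then show ?thesis using i j unfolding touching_def by (intro exI[of _ i]) simp
  qed (use aux[of A B i j] aux[of B A j i] touching_sym i j assms in auto)
qed

lemma touching_lower_lower:
  assumes "finite V" "A \<in> F" "B \<in> F" "p \<in> V - A" "p \<in> V - B"
  shows "touching w (V - A) (V - B)"
proof -
  have aux: "touching w (V - A) (V - B)"
    if AB: "A \<in> F" "B \<in> F" "p \<in> V - A" "p \<in> V - B"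
      and ij: "k \<le> i" "i < j" "j < n" "w i \<in> V - A" "w j \<in> V - B"
    for A B i j
  proof (rule ccontr)
    assume "\<not> touching w (V - A) (V - B)"
    then obtain g where g: "i < g" "g < j" "w g \<notin> V - A" "w g \<notin> V - B"
      using gap_between[OF ij(2,4,5)] by blast
    then have "w g < w i" "w j < w g" "g \<in> {k..<n}" "w g \<in> A" "w g \<in> B"
      using lower_mono ij w_in_V_all by auto
    then have "\<not> w g < p" "\<not> p < w g" using lowerD AB ij by blast+
    then show False using \<open>w g \<in> A\<close> AB by auto
  qed
  obtain i where i: "i \<in> {k..<n}" "w i \<in> V - A" using lower_meets assms by blast
  obtain j where j: "j \<in> {k..<n}" "w j \<in> V - B" using lower_meets assms by blast
  consider "i < j" | "j < i" | "i = j" by linarith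
  then show ?thesis
  proof cases
    case 3
    then show ?thesis using i j unfolding touching_def by (intro exI[of _ i]) simp
  qed (use aux[of A B i j] aux[of B A j i] touching_sym i j assms in auto)
qed

text \<open>If the two arcs do not touch, both gaps between them contain a vertex of \<open>B - A\<close>. One of these
  lies left of \<open>p\<close> and the other right of it, against ABA-freeness.\<close>

lemma touching_upper_lower:
  assumes "finite V" and A: "A \<in> F" and B: "B \<in> F" and p: "p \<in> A" "p \<in> V - B"
  shows "touching w A (V - B)"
proof (rule ccontr)
  assume no: "\<not> touching w A (V - B)"
  obtain i where i: "i \<in> {0..<k}" "w i \<in> A" using upper_meets assms by blast
  obtain j where j: "j \<in> {k..<n}" "w j \<in> V - B" using lower_meets assms by blast
  have disj: "\<not> (w m \<in> A \<and> w m \<in> V - B)" for m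
    using no unfolding touching_def by (metis abs_0 diff_self zero_le_one)
  have wi: "w i \<notin> V - B" and wj: "w j \<notin> A" using disj i(2) j(2) by blast+
  obtain g where g: "i < g" "g < j" "w g \<notin> A" "w g \<notin> V - B"
    using gap_between[of i j w A "V - B"] i j no by auto
  have "w g \<in> B" using g w_in_V_all by blast
  \<comment> \<open>Otherwise \<open>w g\<close> is skipped: on the upper hull by \<open>A\<close>
    through \<open>w i\<close> and \<open>p\<close>, on the lower hull by \<open>V - B\<close>
    through \<open>w j\<close> and \<open>p\<close>.\<close>
  have "p < w g"
  proof (cases "g < k")
    case True
    then have "\<not> w g < p" using upperD[OF A i(2) p(1), of g] g i upper_mono[of i g] by auto
    then show ?thesis using g(3) p(1) by (metis linorder_neqE)
  next
    case False
    then have "\<not> w g < p"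
      using lowerD[OF B j(2) p(2), of g] g j lower_mono[of g j] \<open>w g \<in> B\<close> by auto
    then show ?thesis using g(3) p(1) by (metis linorder_neqE)
  qed
  \<comment> \<open>The second gap runs from \<open>j\<close> past the end of the period to the next
    copy of \<open>i\<close>.\<close>
  obtain g' where g': "j < g'" "g' < i + n" "w g' \<notin> A" "w g' \<notin> V - B"
    using gap_between[of j "i + n" w "V - B" A] i j no touching_sym period by force
  have "w g' \<in> B" using g' w_in_V_all by blast
  have "w g' < p"
  proof (cases "g' < n")
    case True
    then have "\<not> p < w g'"
      using lowerD[OF B p(2) j(2), of g'] g' j lower_mono[of j g'] \<open>w g' \<in> B\<close> by auto
    then show ?thesis using g'(3) p(1) by (metis linorder_neqE)
  next
    case False
    define h where "h = g' - n"
    have h: "w h = w g'" "0 \<le> h" "h < i" using False g' period[of h] unfolding h_def by auto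
    then have "\<not> p < w g'" using upperD[OF A p(1) i(2), of h] g' i upper_mono[of h i] by auto
    then show ?thesis using g'(3) p(1) by (metis linorder_neqE)
  qed
  show False
    using ABA_freeD[OF ABA B A, of "w g'" p "w g"] \<open>w g' < p\<close> \<open>p < w g\<close> g g' p
      \<open>w g \<in> B\<close> \<open>w g' \<in> B\<close> by blast
qed

lemma touching_hyperedges:
  assumes fin: "finite V" and E: "E \<in> F \<union> complement_family V F" "E' \<in> F \<union> complement_family V F"
    and "E \<inter> E' \<noteq> {}"
  shows "touching w E E'"
proof -
  obtain A where A: "A \<in> F" "E = A \<or> E = V - A"
    using E unfolding complement_family_def by blast
  obtain B where B: "B \<in> F" "E' = B \<or> E' = V - B"
    using E unfolding complement_family_def by blast
  obtain p where p: "p \<in> E" "p \<in> E'" using assms(4) by blast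
  consider "E = A" "E' = B" | "E = A" "E' = V - B" | "E = V - A" "E' = B" | "E = V - A" "E' = V - B"
    using A B by blast
  then show ?thesis
    using touching_upper_upper[OF fin A(1) B(1)] touching_upper_lower[OF fin A(1) B(1)]
      touching_sym[OF touching_upper_lower[OF fin B(1) A(1)]]
      touching_lower_lower[OF fin A(1) B(1)] p
    by cases blast+
qed

end

section \<open>Construction of the walk\<close>

lemma hull_walk_exists:
  assumes "finite V" "V \<noteq> {}" "ABA_free V F"
  shows "\<exists>w n k. hull_walk w n V F k"
proof -
  define T B where "T = unskippable V F" and "B = unskippable V (complement_family V F)"
  have TV: "T \<subseteq> V" "B \<subseteq> V" unfolding T_def B_def unskippable_def by auto
  then have fin: "finite T" "finite B" using assms(1) finite_subset by auto
  \<comment> \<open>No vertex precedes the minimum, so it is never skipped; this makes the period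
    positive.\<close>
  have "Min V \<in> T"
    using assms unfolding T_def unskippable_def ABA_free_def hypergraph_def
    by (auto dest!: subsetD simp: Min_le leD)
  define ts bs where "ts = sorted_list_of_set T" and "bs = rev (sorted_list_of_set B)"
  have sets: "set ts = T" "set bs = B" unfolding ts_def bs_def using fin by auto
  have sorted: "sorted_wrt (<) ts" "sorted_wrt (>) bs"
    unfolding ts_def bs_def by (auto simp: sorted_wrt_rev)
  define n k where "n = int (length (ts @ bs))" and "k = int (length ts)"
  \<comment> \<open>The upper list, increasing, is followed by the lower list, decreasing, and
    repeated with period \<open>n\<close>.\<close>
  define w where "w = (\<lambda>i. (ts @ bs) ! nat (i mod n))"
  have "ts \<noteq> []" using \<open>Min V \<in> T\<close> sets by auto
  then have n: "0 < n" unfolding n_def by (cases ts) auto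
  have up: "w i = ts ! nat i" "nat i < length ts" if "i \<in> {0..<k}" for i
    using that unfolding w_def n_def k_def by (auto simp: nth_append)
  have low: "w i = bs ! nat (i - k)" "nat (i - k) < length bs" if "i \<in> {k..<n}" for i
    using that unfolding w_def n_def k_def by (auto simp: nth_append nat_diff_distrib)
  have "hull_walk w n V F k"
  proof
    show "0 < n" by (rule n)
    show "w (i + n) = w i" for i unfolding w_def by simp
    show "ABA_free V F" by (rule assms(3))
    show "0 \<le> k" "k \<le> n" unfolding k_def n_def by auto
    show "w i \<in> unskippable V F" if "i \<in> {0..<k}" for i
      using up[OF that] sets nth_mem unfolding T_def by metis
    show "w i \<in> unskippable V (complement_family V F)" if "i \<in> {k..<n}" for i
      using low[OF that] sets nth_mem unfolding B_def by metis
    show "w i < w j" if "0 \<le> i" "i < j" "j < k" for i j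
      using up[of i] up[of j] that sorted_wrt_nth_less[OF sorted(1), of "nat i" "nat j"] by auto
    show "w j < w i" if "k \<le> i" "i < j" "j < n" for i j
      using low[of i] low[of j] that
        sorted_wrt_nth_less[OF sorted(2), of "nat (i - k)" "nat (j - k)"] by auto
    show "\<exists>i\<in>{0..<k}. w i = v" if "v \<in> unskippable V F" for v
    proof -
      have "v \<in> set ts" using that sets unfolding T_def by simp
      then obtain m where m: "m < length ts" "ts ! m = v" unfolding in_set_conv_nth by blast
      then have "int m \<in> {0..<k}" unfolding k_def by simp
      moreover from this have "w (int m) = v" using up(1) m(2) by simp
      ultimately show ?thesis by blast
    qed
    show "\<exists>i\<in>{k..<n}. w i = v" if "v \<in> unskippable V (complement_family V F)" for v
    proof -
      have "v \<in> set bs" using that sets unfolding B_def by simp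
      then obtain m where m: "m < length bs" "bs ! m = v" unfolding in_set_conv_nth by blast
      then have "k + int m \<in> {k..<n}" unfolding k_def n_def by simp
      moreover from this have "w (k + int m) = v" using low(1) m(2) by simp
      ultimately show ?thesis by blast
    qed
  qed
  then show ?thesis by blast
qed

theorem mainTheorem3:
  fixes V :: "'a::linorder set" and H :: "'a set set"
  assumes "finite V"
    and "pseudohalfplane_hypergraph V H"
    and "pairwise_intersecting H"
  shows "\<exists>S. S \<subseteq> V \<and> card S \<le> 3 \<and> hitting_set S H"
proof (cases "H = {}")
  \<comment> \<open>Treated apart because \<open>V\<close> may be empty here; any hyperedge meets
    itself and so forces \<open>V\<close> to be nonempty.\<close>
  case True
  then show ?thesis unfolding hitting_set_def by (intro exI[of _ "{}"]) auto
next
  case False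
  obtain F where F: "ABA_free V F" "H \<subseteq> F \<union> complement_family V F" and HV: "H \<subseteq> Pow V"
    using assms(2) unfolding pseudohalfplane_hypergraph_def hypergraph_def by blast
  have meet: "E \<inter> E' \<noteq> {}" if "E \<in> H" "E' \<in> H" for E E'
    using assms(3) that unfolding pairwise_intersecting_def by blast
  then have "V \<noteq> {}" using False HV by blast
  then obtain w n k where "hull_walk w n V F k" using hull_walk_exists assms(1) F(1) by blast
  then interpret hull_walk w n V F k .
  have touch: "touching w E E'" if "E \<in> H" "E' \<in> H" for E E'
    using touching_hyperedges[OF assms(1) _ _ meet[OF that]] F(2) that by blast
  have "\<exists>i j k. \<forall>E\<in>H. w i \<in> E \<or> w j \<in> E \<or> w k \<in> E"
  proof (rule three_points_hit_touching_arcs)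
    show "cyclic_convex w n E" if "E \<in> H" for E
      using cyclic_convex_hyperedge F(2) that by blast
    \<comment> \<open>A hyperedge touches itself, hence has a letter on the walk.\<close>
    show "\<exists>i. w i \<in> E" if "E \<in> H" for E
      using touch[OF that that] unfolding touching_def by blast
  qed (rule touch)
  then obtain i j l where hit: "\<forall>E\<in>H. w i \<in> E \<or> w j \<in> E \<or> w l \<in> E" by blast
  show ?thesis
  proof (intro exI conjI)
    show "{w i, w j, w l} \<subseteq> V" using w_in_V_all by simp
    show "card {w i, w j, w l} \<le> 3" by (simp add: card_insert_if)
    show "hitting_set {w i, w j, w l} H" using hit unfolding hitting_set_def by blast
  qed
qed

end
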